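(* Let $F$ be a forest with no isolated vertices. Then $$\frac13\big(|\mathit{Deg}_{\ge2}(F)|+|\mathit{Supp}(F)|\big)\le\phi(F)\le\frac12\big(|\mathit{Deg}_{\ge2}(F)|+|\mathit{Supp}(F)|\big).$$
   Context: $\phi(F)$ is the matching number (size of a maximum matching) of $F$. $\mathit{Deg}_{\ge2}(F)$ is the set of vertices of degree at least $2$. $\mathit{Supp}(F)$ is the set of support vertices, i.e., vertices adjacent to at least one leaf (vertex of degree $1$). *)

theory Defs
  imports Complex_Main "Graph_Theory.Arc_Walk"
begin

text \<open>
  A finite simple graph is a digraph satisfying the locale \<^locale>\<open>graph\<close>: finite, loop-free,
  without parallel arcs and symmetric. Each undirected edge is represented by its two
  orientations, so counting edges has to be done on the set of unordered pairs of end points.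
\<close>

definition uedges :: "('a, 'b) pre_digraph \<Rightarrow> 'a set set" where
  "uedges G = (\<lambda>a. {tail G a, head G a}) ` arcs G"

text \<open>In a symmetric digraph without parallel arcs, the out-degree is the number of incident edges.\<close>

abbreviation degree :: "('a, 'b) pre_digraph \<Rightarrow> 'a \<Rightarrow> nat" where
  "degree G v \<equiv> out_degree G v"

lemma (in graph) degree_eq_card_uedges:
  "degree G v = card {e \<in> uedges G. v \<in> e}"
proof -
  let ?f = "\<lambda>a. {tail G a, head G a}"
  have "inj_on ?f (out_arcs G v)"
  proof (rule inj_onI)
    fix a b assume "a \<in> out_arcs G v" "b \<in> out_arcs G v" "?f a = ?f b"
    then show "a = b"
      using no_multi_arcs[of a b] unfolding arc_to_ends_def by (metis doubleton_eq_iff in_out_arcs_conv)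
  qed
  moreover have "{e \<in> uedges G. v \<in> e} = ?f ` out_arcs G v"
  proof (intro equalityI subsetI)
    fix e assume "e \<in> {e \<in> uedges G. v \<in> e}"
    then obtain a where a: "a \<in> arcs G" "e = ?f a" "v = tail G a \<or> v = head G a"
      by (auto simp: uedges_def)
    obtain b where b: "b \<in> arcs G" "head G b = tail G a" "tail G b = head G a"
      using sym_arcs a(1) unfolding symmetric_conv by metis
    have "?f b = ?f a"
      unfolding b by (rule insert_commute)
    show "e \<in> ?f ` out_arcs G v"
    proof (cases "v = tail G a")
      case True
      then show ?thesis using a by (intro image_eqI[of _ _ a]) simp_all
    next
      case False
      then have "b \<in> out_arcs G v" using a(3) b by simp
      with \<open>?f b = ?f a\<close> a(2) show ?thesis by blast
    qed
  next
    fix e assume "e \<in> ?f ` out_arcs G v"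
    then show "e \<in> {e \<in> uedges G. v \<in> e}"
      unfolding uedges_def by auto
  qed
  ultimately show ?thesis
    by (metis card_image out_degree_def)
qed

text \<open>
  The library's \<open>cycle\<close> is the one for digraphs, under which every edge traversed back and forth
  is a cycle of length 2 (so the library's \<open>forest\<close> excludes all symmetric digraphs with an edge).
  Since the vertices of a \<open>cycle\<close> are distinct, those of length at least 3 are exactly the cycles of
  the undirected graph.
\<close>

definition undirected_forest :: "('a, 'b) pre_digraph \<Rightarrow> bool" where
  "undirected_forest G \<longleftrightarrow> graph G \<and> \<not> (\<exists>p. pre_digraph.cycle G p \<and> length p \<ge> 3)"

definition matching :: "('a, 'b) pre_digraph \<Rightarrow> 'a set set \<Rightarrow> bool" where
  "matching G M \<longleftrightarrow> M \<subseteq> uedges G \<and> (\<forall>e\<in>M. \<forall>f\<in>M. e \<noteq> f \<longrightarrow> e \<inter> f = {})"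

definition matching_number :: "('a, 'b) pre_digraph \<Rightarrow> nat" where
  "matching_number G = Max {card M | M. matching G M}"

definition isolated :: "('a, 'b) pre_digraph \<Rightarrow> 'a \<Rightarrow> bool" where
  "isolated G v \<longleftrightarrow> v \<in> verts G \<and> degree G v = 0"

definition leaf :: "('a, 'b) pre_digraph \<Rightarrow> 'a \<Rightarrow> bool" where
  "leaf G v \<longleftrightarrow> v \<in> verts G \<and> degree G v = 1"

definition Deg_ge2 :: "('a, 'b) pre_digraph \<Rightarrow> 'a set" where
  "Deg_ge2 G = {v \<in> verts G. degree G v \<ge> 2}"

definition Supp :: "('a, 'b) pre_digraph \<Rightarrow> 'a set" where
  "Supp G = {v \<in> verts G. \<exists>w. leaf G w \<and> v \<rightarrow>\<^bsub>G\<^esub> w}"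

end

theory Submission
  imports Defs
begin

text \<open>
  Give every vertex one unit of weight for lying in \<open>Deg_ge2\<close> and one for lying in \<open>Supp\<close>. Every
  edge has weight at least 2, and exactly 2 if it is pendant; this is the upper bound. For the
  lower bound, let \<open>R\<close> consist of the vertices of \<open>Deg_ge2\<close> outside \<open>Supp\<close>, and take a maximal
  matching \<open>M\<close> among the pendant edges and a maximal matching \<open>N\<close> among the edges inside \<open>R\<close>. Then
  \<open>M\<close> covers \<open>Supp\<close>, whose weight is thus at most \<open>2|M|\<close>. The \<open>N\<close>-uncovered vertices \<open>U\<close> of \<open>R\<close> are
  independent and have no leaf neighbours, so the forest induced by \<open>Deg_ge2\<close> has at least
  \<open>2|U| + |N|\<close> edges; comparing with its number of vertices gives
  \<open>|R| \<le> 3|N| + |Deg_ge2 \<inter> Supp| \<le> 3|N| + |M|\<close>.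
\<close>

context graph
begin

section \<open>Undirected edges of a symmetric digraph\<close>

lemma uedge_iff_dominates: "{u, v} \<in> uedges G \<longleftrightarrow> u \<rightarrow> v"
proof
  assume "{u, v} \<in> uedges G"
  then obtain a where "a \<in> arcs G" "{u, v} = {tail G a, head G a}"
    by (auto simp: uedges_def)
  then have "u \<rightarrow> v \<or> v \<rightarrow> u"
    by (auto simp: arcs_ends_conv doubleton_eq_iff)
  then show "u \<rightarrow> v"
    using arcs_ends_symmetric[OF sym_arcs] by blast
qed (auto simp: uedges_def)

lemma uedgeE:
  assumes "e \<in> uedges G"
  obtains u v where "e = {u, v}" "u \<noteq> v" "u \<in> verts G" "v \<in> verts G"
proof -
  from assms obtain a where "a \<in> arcs G" "e = {tail G a, head G a}"
    by (auto simp: uedges_def)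
  then show thesis
    using that no_loops by simp
qed

lemma uedge_containsE:
  assumes "e \<in> uedges G" "u \<in> e"
  obtains v where "e = {u, v}" "u \<noteq> v" "u \<in> verts G" "v \<in> verts G"
  using assms(1)
proof (cases rule: uedgeE)
  case (1 a b)
  then consider "u = a" | "u = b"
    using assms(2) by blast
  then show thesis
  proof cases
    case 1
    with \<open>e = {a, b}\<close> \<open>a \<noteq> b\<close> \<open>a \<in> verts G\<close> \<open>b \<in> verts G\<close> show thesis
      using that[of b] by simp
  next
    case 2
    with \<open>e = {a, b}\<close> \<open>a \<noteq> b\<close> \<open>a \<in> verts G\<close> \<open>b \<in> verts G\<close> show thesis
      using that[of a] by (simp add: insert_commute)
  qed
qed

lemma finite_uedges: "finite (uedges G)"
  by (simp add: uedges_def)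

lemma uedges_nonempty: "e \<in> uedges G \<Longrightarrow> e \<noteq> {}"
  by (auto simp: uedges_def)

lemma finite_uedge: "e \<in> uedges G \<Longrightarrow> finite e"
  by (auto simp: uedges_def)

lemma card_uedge: "e \<in> uedges G \<Longrightarrow> card e = 2"
  by (elim uedgeE) auto

lemma uedge_subset_verts: "e \<in> uedges G \<Longrightarrow> e \<subseteq> verts G"
  by (elim uedgeE) auto


subsection \<open>Edges of induced subgraphs of a forest\<close>

text \<open>Take the start \<open>x\<close> of a longest path inside \<open>W\<close>. A neighbour
  of \<open>x\<close> in \<open>W\<close> off the path would extend it, and one on the path beyond
  the second vertex would close a cycle.\<close>

lemma acyclic_ex_card_incident_le_1:
  assumes acyclic: "\<nexists>p. cycle p \<and> length p \<ge> 3" and W: "W \<subseteq> verts G" "W \<noteq> {}"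
  shows "\<exists>x\<in>W. card {e \<in> uedges G. e \<subseteq> W \<and> x \<in> e} \<le> 1"
proof -
  define P where "P = (\<lambda>n. \<exists>x p y. apath x p y \<and> set (awalk_verts x p) \<subseteq> W \<and> length p = n)"
  have "finite W"
    using W(1) by (rule finite_subset) simp
  have "n \<le> card W" if "P n" for n
  proof -
    from that obtain x p y where
      p: "apath x p y" "set (awalk_verts x p) \<subseteq> W" "length p = n"
      by (auto simp: P_def)
    then have "Suc n = card (set (awalk_verts x p))"
      by (simp add: apath_def distinct_card length_awalk_verts)
    also have "\<dots> \<le> card W"
      using p \<open>finite W\<close> by (intro card_mono)
    finally show ?thesis by simp
  qed
  moreover have "P 0"
    using W by (force simp: P_def apath_Nil_iff)
  ultimately obtain n where "P n" and n_max: "\<And>m. P m \<Longrightarrow> m \<le> n"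
    by (metis Nat.ex_has_greatest_nat)
  then obtain x p y where
    p: "apath x p y" "set (awalk_verts x p) \<subseteq> W" "length p = n"
    by (auto simp: P_def)
  have "x \<in> W"
    using p hd_in_awalk_verts(2) by blast
  \<comment> \<open>If \<open>p\<close> is empty, \<open>hd p\<close> is unspecified, but then
    \<open>x\<close> has no neighbour in \<open>W\<close>: one other than \<open>x\<close> would
    extend the path, and loops are excluded.\<close>
  have unique: "z = head G (hd p)" if z: "z \<in> W" "{x, z} \<in> uedges G" for z
  proof (rule ccontr)
    assume neq: "z \<noteq> head G (hd p)"
    from z obtain a where a: "a \<in> arcs G" "tail G a = z" "head G a = x"
      by (metis insert_commute reachableE uedge_iff_dominates)
    show False
    proof (cases "z \<in> set (awalk_verts x p)")
      case False
      then have "apath z (a # p) y" "set (awalk_verts z (a # p)) \<subseteq> W"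
        using p a z by (auto simp: apath_Cons_iff)
      then have "P (Suc n)"
        using p(3) unfolding P_def by (metis length_Cons)
      then show False
        using n_max by fastforce
    next
      case True
      obtain q r where qr: "p = q @ r" "awalk x q z" "awalk z r y"
        using awalk_decomp[of x p y z] p True by (auto simp: apath_def)
      have "distinct (awalk_verts x q)"
        using p(1) qr awalk_verts_append[of x q r y] by (auto simp: apath_def)
      then have "cycle (a # q)"
        using a qr by (auto simp: cycle_def awalk_Cons_iff)
      \<comment> \<open>This makes \<open>a # q\<close> long enough to be an undirected cycle: an
        empty \<open>q\<close> would turn \<open>a\<close> into a loop, and a single arc would make
        \<open>z\<close> the second vertex of the path.\<close>
      moreover have "length q \<ge> 2"
      proof (rule ccontr)
        assume "\<not> length q \<ge> 2"
        then consider "q = []" | b where "q = [b]"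
          by (cases q; cases "tl q") auto
        then show False
          using qr(1,2) a neq no_loops[OF a(1)] by cases (auto simp: awalk_simps)
      qed
      ultimately show False
        using acyclic by fastforce
    qed
  qed
  have "{e \<in> uedges G. e \<subseteq> W \<and> x \<in> e} \<subseteq> {{x, head G (hd p)}}"
  proof
    fix e assume "e \<in> {e \<in> uedges G. e \<subseteq> W \<and> x \<in> e}"
    then have e: "e \<in> uedges G" "e \<subseteq> W" "x \<in> e" by auto
    then obtain z where z: "e = {x, z}"
      by (metis uedge_containsE)
    then have "z = head G (hd p)"
      using e by (intro unique) auto
    then show "e \<in> {{x, head G (hd p)}}"
      using z by simp
  qed
  then have "card {e \<in> uedges G. e \<subseteq> W \<and> x \<in> e} \<le> card {{x, head G (hd p)}}"
    by (intro card_mono) auto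
  then show ?thesis
    using \<open>x \<in> W\<close> by auto
qed

text \<open>Deleting a vertex with at most one incident edge inside \<open>W\<close> loses at most
  one edge, so induction on \<open>card W\<close> applies.\<close>

lemma acyclic_card_induced_edges_le:
  assumes acyclic: "\<nexists>p. cycle p \<and> length p \<ge> 3" and "W \<subseteq> verts G"
  shows "card {e \<in> uedges G. e \<subseteq> W} \<le> card W"
  using \<open>W \<subseteq> verts G\<close>
proof (induction "card W" arbitrary: W rule: less_induct)
  case less
  have "finite W"
    using less.prems by (rule finite_subset) simp
  show ?case
  proof (cases "W = {}")
    case True
    then have no_edges: "{e \<in> uedges G. e \<subseteq> W} = {}"
      using uedges_nonempty by auto
    show ?thesis
      unfolding no_edges by simp
  next
    case False
    then obtain x where x: "x \<in> W" "card {e \<in> uedges G. e \<subseteq> W \<and> x \<in> e} \<le> 1"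
      using acyclic_ex_card_incident_le_1[OF acyclic less.prems] by blast
    have card_W: "card W = Suc (card (W - {x}))"
      using \<open>finite W\<close> x(1) by (metis card_Suc_Diff1)
    have split: "{e \<in> uedges G. e \<subseteq> W} =
        {e \<in> uedges G. e \<subseteq> W - {x}} \<union> {e \<in> uedges G. e \<subseteq> W \<and> x \<in> e}"
      by auto
    have "card {e \<in> uedges G. e \<subseteq> W} \<le>
        card {e \<in> uedges G. e \<subseteq> W - {x}} + card {e \<in> uedges G. e \<subseteq> W \<and> x \<in> e}"
      by (subst split) (rule card_Un_le)
    also have "\<dots> \<le> card (W - {x}) + 1"
      using less.hyps[of "W - {x}"] less.prems card_W x(2) by (intro add_mono) auto
    finally show ?thesis
      using card_W by simp
  qed
qed


subsection \<open>Matchings\<close>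

lemma finite_matching: "matching G M \<Longrightarrow> finite M"
  using finite_uedges finite_subset by (auto simp: matching_def)

lemma finite_matching_cards: "finite {card M | M. matching G M}"
proof -
  have "{card M | M. matching G M} \<subseteq> card ` Pow (uedges G)"
    by (auto simp: matching_def)
  then show ?thesis
    by (rule finite_subset) (simp add: finite_uedges)
qed

lemma card_matching_le: "matching G M \<Longrightarrow> card M \<le> matching_number G"
  unfolding matching_number_def by (intro Max_ge finite_matching_cards) auto

lemma ex_maximum_matching: "\<exists>M. matching G M \<and> card M = matching_number G"
proof -
  have "matching G {}"
    by (simp add: matching_def)
  then have "matching_number G \<in> {card M | M. matching G M}"
    unfolding matching_number_def by (intro Max_in finite_matching_cards) blast
  then show ?thesis by auto
qed

text \<open>Maximality is by inclusion among the matchings within \<open>E\<close>: an edge of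
  \<open>E\<close> missing all covered vertices could be added.\<close>

lemma ex_maximal_matching:
  assumes "E \<subseteq> uedges G"
  obtains M where "matching G M" "M \<subseteq> E" "\<And>e. e \<in> E \<Longrightarrow> e \<inter> \<Union>M \<noteq> {}"
proof -
  let ?A = "{M. matching G M \<and> M \<subseteq> E}"
  have "finite ?A"
    using finite_subset[OF assms finite_uedges] by (rule_tac finite_subset[of _ "Pow E"]) auto
  moreover have "{} \<in> ?A"
    by (simp add: matching_def)
  ultimately have "\<exists>M\<in>?A. \<forall>N\<in>?A. M \<subseteq> N \<longrightarrow> M = N"
    by (intro finite_has_maximal) blast+
  then obtain M where M: "M \<in> ?A" and max: "\<And>N. N \<in> ?A \<Longrightarrow> M \<subseteq> N \<Longrightarrow> M = N"
    by (elim bexE) simp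
  have "e \<inter> \<Union>M \<noteq> {}" if "e \<in> E" for e
  proof
    assume disj: "e \<inter> \<Union>M = {}"
    then have "insert e M \<in> ?A"
      using M that assms by (auto simp: matching_def)
    then have "e \<in> M"
      using max by blast
    then show False
      using disj that assms uedges_nonempty by blast
  qed
  with M that show thesis by blast
qed

lemma sum_matching:
  fixes f :: "'a \<Rightarrow> nat"
  assumes "matching G M"
  shows "sum f (\<Union>M) = (\<Sum>e\<in>M. sum f e)"
proof (subst sum.Union_disjoint)
  show "\<forall>e\<in>M. finite e" "\<forall>e\<in>M. \<forall>e'\<in>M. e \<noteq> e' \<longrightarrow> e \<inter> e' = {}"
    using assms finite_uedge by (auto simp: matching_def)
qed simp


subsection \<open>The weight of an edge\<close>

lemma Supp_iff: "v \<in> Supp G \<longleftrightarrow> (\<exists>w. leaf G w \<and> {v, w} \<in> uedges G)"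
  by (auto simp: Supp_def uedge_iff_dominates dest: adj_in_verts)

lemma leaf_unique_uedge:
  assumes "leaf G w" "e \<in> uedges G" "e' \<in> uedges G" "w \<in> e" "w \<in> e'"
  shows "e = e'"
proof -
  have "card {e \<in> uedges G. w \<in> e} = 1"
    using assms(1) degree_eq_card_uedges by (simp add: leaf_def)
  then obtain d where "{e \<in> uedges G. w \<in> e} = {d}"
    by (rule card_1_singletonE)
  moreover have "e \<in> {e \<in> uedges G. w \<in> e}" "e' \<in> {e \<in> uedges G. w \<in> e}"
    using assms(2-) by simp_all
  ultimately show ?thesis by simp
qed

lemma leaf_or_Deg_ge2:
  assumes "e \<in> uedges G" "v \<in> e"
  shows "leaf G v \<or> v \<in> Deg_ge2 G"
proof -
  have "v \<in> verts G"
    using assms uedge_subset_verts by blast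
  moreover have "degree G v \<noteq> 0"
    using assms finite_uedges by (auto simp: degree_eq_card_uedges)
  ultimately show ?thesis
    by (auto simp: leaf_def Deg_ge2_def)
qed

lemma leaf_notin_Deg_ge2: "leaf G v \<Longrightarrow> v \<notin> Deg_ge2 G"
  by (simp add: leaf_def Deg_ge2_def)

definition weight :: "'a \<Rightarrow> nat" where
  "weight v = of_bool (v \<in> Deg_ge2 G) + of_bool (v \<in> Supp G)"

lemma finite_Deg_ge2: "finite (Deg_ge2 G)" and finite_Supp: "finite (Supp G)"
  by (simp_all add: Deg_ge2_def Supp_def)

lemma sum_weight:
  assumes "finite A"
  shows "sum weight A = card (A \<inter> Deg_ge2 G) + card (A \<inter> Supp G)"
  using assms by (simp add: weight_def sum.distrib flip: sum.inter_filter)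

lemma weight_pendant_uedge:
  assumes "e \<in> uedges G" "w \<in> e" "leaf G w"
  shows "sum weight e = 2"
proof -
  obtain v where e: "e = {w, v}" "w \<noteq> v"
    using assms by (metis uedge_containsE)
  have "v \<in> Supp G"
    using assms e by (auto simp: Supp_iff insert_commute)
  \<comment> \<open>The second unit of weight comes from \<open>v\<close> having degree at least 2
    or, if \<open>v\<close> is a leaf too and the edge is a whole component, from \<open>w\<close>
    being a support vertex.\<close>
  moreover have "w \<in> Supp G \<longleftrightarrow> leaf G v"
  proof
    assume "w \<in> Supp G"
    then obtain v' where "leaf G v'" "{w, v'} \<in> uedges G"
      by (auto simp: Supp_iff)
    then show "leaf G v"
      using leaf_unique_uedge[OF assms(3,1), of "{w, v'}"] e by (auto simp: doubleton_eq_iff)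
  qed (use assms e in \<open>auto simp: Supp_iff\<close>)
  moreover have "v \<in> Deg_ge2 G \<longleftrightarrow> \<not> leaf G v"
    using leaf_or_Deg_ge2[OF assms(1), of v] leaf_notin_Deg_ge2[of v] e by auto
  ultimately show ?thesis
    using e leaf_notin_Deg_ge2[OF assms(3)] by (simp add: weight_def)
qed

lemma weight_uedge_ge:
  assumes "e \<in> uedges G"
  shows "sum weight e \<ge> 2"
proof (cases "\<exists>w\<in>e. leaf G w")
  case True
  then show ?thesis
    using assms weight_pendant_uedge by fastforce
next
  case False
  then have "e \<subseteq> Deg_ge2 G"
    using leaf_or_Deg_ge2[OF assms] by blast
  then have "(\<Sum>v\<in>e. 1) \<le> sum weight e"
    by (intro sum_mono) (auto simp: weight_def)
  then show ?thesis
    by (simp add: card_uedge assms)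
qed

text \<open>The edges of a maximum matching are disjoint and each carries weight at least 2, while
  all vertices together carry the right-hand side.\<close>

lemma matching_number_le:
  "2 * matching_number G \<le> card (Deg_ge2 G) + card (Supp G)"
proof -
  obtain M where M: "matching G M" "card M = matching_number G"
    using ex_maximum_matching by blast
  have "2 * card M = (\<Sum>e\<in>M. 2)"
    by simp
  also have "\<dots> \<le> (\<Sum>e\<in>M. sum weight e)"
    using M(1) weight_uedge_ge by (intro sum_mono) (auto simp: matching_def)
  also have "\<dots> = sum weight (\<Union>M)"
    by (simp add: sum_matching M)
  also have "\<dots> \<le> sum weight (verts G)"
    using M(1) uedge_subset_verts by (intro sum_mono2) (auto simp: matching_def)
  also have "\<dots> = card (Deg_ge2 G) + card (Supp G)"
    by (subst sum_weight) (auto intro!: arg_cong2[where f = "(+)"] arg_cong[where f = card]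
        simp: Deg_ge2_def Supp_def)
  finally show ?thesis
    using M(2) by simp
qed


subsection \<open>The lower bound\<close>

lemma acyclic_card_Deg_ge2_minus_Supp_le:
  assumes acyclic: "\<nexists>p. cycle p \<and> length p \<ge> 3"
    and N: "matching G N" "\<Union>N \<subseteq> Deg_ge2 G - Supp G"
    and maximal: "\<And>e. e \<in> uedges G \<Longrightarrow> e \<subseteq> Deg_ge2 G - Supp G \<Longrightarrow> e \<inter> \<Union>N \<noteq> {}"
  shows "card (Deg_ge2 G - Supp G) \<le> 3 * card N + card (Deg_ge2 G \<inter> Supp G)"
proof -
  let ?D = "Deg_ge2 G" and ?R = "Deg_ge2 G - Supp G"
  define U where "U = ?R - \<Union>N"
  define I where "I = (\<lambda>u. {e \<in> uedges G. u \<in> e})"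
  have "finite ?R" "finite U"
    using finite_Deg_ge2 by (auto simp: U_def)
  have I_sub: "e \<subseteq> ?D" if "u \<in> U" "e \<in> I u" for u e
  proof
    fix v assume "v \<in> e"
    obtain v' where e: "e = {u, v'}" "e \<in> uedges G"
      using \<open>e \<in> I u\<close> unfolding I_def by (auto elim: uedge_containsE)
    \<comment> \<open>A leaf neighbour would put \<open>u\<close> into
      \<open>Supp G\<close>.\<close>
    have "\<not> leaf G v'"
      using that e by (auto simp: U_def Supp_iff)
    then have "v' \<in> ?D"
      using leaf_or_Deg_ge2[OF e(2)] e(1) by blast
    then show "v \<in> ?D"
      using \<open>v \<in> e\<close> e(1) \<open>u \<in> U\<close> by (auto simp: U_def)
  qed
  \<comment> \<open>A common edge would join \<open>u\<close> and \<open>u'\<close>, hence lie in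
    \<open>?R\<close> without meeting \<open>N\<close>, against maximality.\<close>
  have I_disj: "I u \<inter> I u' = {}" if u: "u \<in> U" "u' \<in> U" "u \<noteq> u'" for u u'
  proof (rule ccontr)
    assume "I u \<inter> I u' \<noteq> {}"
    then obtain e where e: "e \<in> uedges G" "u \<in> e" "u' \<in> e"
      by (auto simp: I_def)
    then have "e = {u, u'}"
      using u(3) by (metis uedge_containsE insertE singletonD)
    then show False
      using maximal[OF e(1)] u by (auto simp: U_def)
  qed
  have "2 * card U = (\<Sum>u\<in>U. 2)"
    by simp
  also have "\<dots> \<le> (\<Sum>u\<in>U. card (I u))"
    by (intro sum_mono) (auto simp: U_def I_def Deg_ge2_def degree_eq_card_uedges)
  also have "\<dots> = card (\<Union>(I ` U))"
    using I_disj \<open>finite U\<close> finite_uedges by (subst card_UN_disjoint) (auto simp: I_def)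
  finally have "2 * card U + card N \<le> card (\<Union>(I ` U)) + card N"
    by simp
  \<comment> \<open>No edge at a vertex of \<open>U\<close> belongs to \<open>N\<close>, since
    \<open>N\<close> leaves \<open>U\<close> uncovered.\<close>
  also have "\<dots> = card (\<Union>(I ` U) \<union> N)"
    using \<open>finite U\<close> finite_uedges finite_matching[OF N(1)]
    by (intro card_Un_disjoint[symmetric]) (auto simp: I_def U_def)
  also have "\<dots> \<le> card {e \<in> uedges G. e \<subseteq> ?D}"
  proof (rule card_mono)
    show "\<Union>(I ` U) \<union> N \<subseteq> {e \<in> uedges G. e \<subseteq> ?D}"
      using I_sub N by (auto simp: I_def matching_def)
  qed (simp add: finite_uedges)
  also have "\<dots> \<le> card ?D"
    by (intro acyclic_card_induced_edges_le acyclic) (auto simp: Deg_ge2_def)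
  also have "\<dots> = card (?D \<inter> Supp G) + card ?R"
    by (rule card_Int_Diff[OF finite_Deg_ge2])
  finally have "2 * card U + card N \<le> card (?D \<inter> Supp G) + card ?R" .
  moreover have "card ?R = 2 * card N + card U"
  proof -
    have "card (\<Union>N) = 2 * card N"
      using sum_matching[OF N(1), of "\<lambda>_. 1"] N(1) by (simp add: card_uedge matching_def subset_iff)
    then show ?thesis
      using card_Int_Diff[OF \<open>finite ?R\<close>, of "\<Union>N"] N(2) by (simp add: U_def Int_absorb1)
  qed
  \<comment> \<open>Eliminating \<open>card ?R\<close> from the two relations bounds
    \<open>card U\<close> by \<open>card N + card (?D \<inter> Supp G)\<close>; adding
    \<open>2 * card N\<close> gives the claim.\<close>
  ultimately show ?thesis by linarith
qed

lemma acyclic_matching_number_ge: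
  assumes acyclic: "\<nexists>p. cycle p \<and> length p \<ge> 3"
  shows "card (Deg_ge2 G) + card (Supp G) \<le> 3 * matching_number G"
proof -
  let ?D = "Deg_ge2 G" and ?S = "Supp G"
  obtain M where M: "matching G M" "M \<subseteq> {e \<in> uedges G. \<exists>w\<in>e. leaf G w}"
    and M_max: "\<And>e. e \<in> {e \<in> uedges G. \<exists>w\<in>e. leaf G w} \<Longrightarrow> e \<inter> \<Union>M \<noteq> {}"
    by (rule ex_maximal_matching[of "{e \<in> uedges G. \<exists>w\<in>e. leaf G w}"]) auto
  obtain N where N: "matching G N" "N \<subseteq> {e \<in> uedges G. e \<subseteq> ?D - ?S}"
    and N_max: "\<And>e. e \<in> {e \<in> uedges G. e \<subseteq> ?D - ?S} \<Longrightarrow> e \<inter> \<Union>N \<noteq> {}"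
    by (rule ex_maximal_matching[of "{e \<in> uedges G. e \<subseteq> ?D - ?S}"]) auto
  \<comment> \<open>By maximality some edge of \<open>M\<close> meets the pendant edge at
    \<open>s\<close>. If it does so in the leaf, it is that pendant edge, so \<open>s\<close> is
    covered either way.\<close>
  have "?S \<subseteq> \<Union>M"
  proof
    fix s assume "s \<in> ?S"
    then obtain w where w: "leaf G w" "{s, w} \<in> uedges G"
      by (auto simp: Supp_iff)
    then obtain e where e: "e \<in> M" "s \<in> e \<or> w \<in> e"
      using M_max[of "{s, w}"] by auto
    then have "w \<in> e \<Longrightarrow> e = {s, w}"
      using leaf_unique_uedge[OF w(1) _ w(2), of e] M(2) by auto
    then show "s \<in> \<Union>M"
      using e by auto
  qed
  moreover have "finite (\<Union>M)"
    using M(1) finite_matching finite_uedge by (auto simp: matching_def)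
  ultimately have "sum weight ?S \<le> sum weight (\<Union>M)"
    by (intro sum_mono2) auto
  also have "\<dots> = (\<Sum>e\<in>M. sum weight e)"
    by (rule sum_matching[OF M(1)])
  also have "\<dots> = 2 * card M"
    using M(2) weight_pendant_uedge by (subst sum.cong[where h = "\<lambda>_. 2"]) auto
  finally have M_ge: "card (?D \<inter> ?S) + card ?S \<le> 2 * card M"
    using sum_weight[OF finite_Supp] by (simp add: Int_commute)
  \<comment> \<open>With \<open>M_ge\<close> this yields
    \<open>card (?D \<inter> ?S) \<le> card M\<close>, so that \<open>?D - ?S\<close> costs at most
    \<open>3 * card N + card M\<close> on top of the \<open>2 * card M\<close> in
    \<open>M_ge\<close>.\<close>
  moreover have "card (?D \<inter> ?S) \<le> card ?S"
    using finite_Supp by (intro card_mono) auto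
  moreover have "card (?D - ?S) \<le> 3 * card N + card (?D \<inter> ?S)"
    using N N_max by (intro acyclic_card_Deg_ge2_minus_Supp_le acyclic) auto
  moreover have "card ?D = card (?D \<inter> ?S) + card (?D - ?S)"
    by (rule card_Int_Diff[OF finite_Deg_ge2])
  ultimately have "card ?D + card ?S \<le> 3 * card M + 3 * card N"
    by linarith
  moreover have "card M + card N = card (M \<union> N) \<and> matching G (M \<union> N)"
  proof -
    \<comment> \<open>A common vertex has degree at least 2, so it is not the leaf end of
      \<open>e\<close>. It is then the neighbour of that leaf, a support vertex, which edges of
      \<open>N\<close> avoid.\<close>
    have disj: "e \<inter> f = {}" if "e \<in> M" "f \<in> N" for e f
    proof (rule ccontr)
      assume "e \<inter> f \<noteq> {}"
      then obtain v where v: "v \<in> e" "v \<in> f" by blast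
      obtain w where w: "w \<in> e" "leaf G w" "e \<in> uedges G"
        using M(2) \<open>e \<in> M\<close> by blast
      have "v \<in> ?D - ?S"
        using N(2) \<open>f \<in> N\<close> v by blast
      moreover from this have "v \<noteq> w"
        using leaf_notin_Deg_ge2[OF w(2)] by blast
      then have "e = {v, w}"
        using w(1,3) v(1) by (metis uedge_containsE insertE singletonD)
      ultimately show False
        using w by (auto simp: Supp_iff)
    qed
    have "M \<inter> N = {}"
      using disj N(2) uedges_nonempty by fastforce
    moreover have "matching G (M \<union> N)"
      using M(1) N(1) disj unfolding matching_def
      by (metis Int_commute Un_iff Un_least)
    ultimately show ?thesis
      using finite_matching M(1) N(1) by (simp add: card_Un_disjoint)
  qed
  ultimately show ?thesis
    using card_matching_le[of "M \<union> N"] by linarith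
qed

end

theorem theorem15:
  fixes F :: "('a, 'b) pre_digraph"
  assumes "undirected_forest F"
    and "\<not> (\<exists>v. isolated F v)"
  shows "1 / 3 * (real (card (Deg_ge2 F)) + real (card (Supp F))) \<le> real (matching_number F)
       \<and> real (matching_number F) \<le> 1 / 2 * (real (card (Deg_ge2 F)) + real (card (Supp F)))"
proof -
  interpret graph F
    using assms(1) by (simp add: undirected_forest_def)
  have "card (Deg_ge2 F) + card (Supp F) \<le> 3 * matching_number F"
    using assms(1) by (intro acyclic_matching_number_ge) (simp add: undirected_forest_def)
  moreover have "2 * matching_number F \<le> card (Deg_ge2 F) + card (Supp F)"
    by (rule matching_number_le)
  ultimately show ?thesis by auto
qed

end
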